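(* Let $0<p<1$ and let $\rho$ be a probability distribution on $\mathbb{R}_+=[0,+\infty)$ with finite mean $$\bar b=\int_0^{+\infty} b\,\rho(b)\,db<+\infty,$$ and suppose that the game with win probability $p$ and variable pay-off distributed according to $\rho$ is favorable, i.e. $p(1+\bar b)>1$. Let $\hat f(p,\rho)$ be the optimal Kelly fraction for this game and let $$f^*(p,\bar b)=\frac{p(1+\bar b)-1}{\bar b}$$ be the optimal Kelly fraction for the same game with constant pay-off equal to $\bar b$. Then $$\hat f(p,\rho)\le f^*(p,\bar b),$$ and equality holds only when the pay-off is constant (that is, only when $\rho$ is a Dirac distribution).
   Context: A game is played repeatedly. At each round the player bets a fixed fraction $f\in[0,1]$ of the current capital $X$. With probability $1-p$ the bet is lost and the capital becomes $(1-f)X$. With probability $p$ the bet is won and the capital becomes $(1+bf)X$, where the pay-off $b\ge 0$ is a random variable with distribution $\rho$. The distribution $\rho$ need not be absolutely continuous: $\rho(b)\,db$ denotes integration against the probability distribution $\rho$. If $X_0>0$ is the initial capital and $X_n$ the capital after $n\ge 1$ rounds, the expected exponential rate of growth is $$g(f)=\mathbb{E}\left(\tfrac1n\log\tfrac{X_n}{X_0}\right)=(1-p)\log(1-f)+p\int_0^{+\infty}\log(1+bf)\,\rho(b)\,db .$$ For a favorable game, the optimal Kelly fraction $\hat f=\hat f(p,\rho)\in(0,1)$ is the fraction maximizing $g$. It is the unique solution in $(0,1)$ of $$p\int_0^{+\infty}\frac{b\,\rho(b)}{1+b\hat f}\,db-\frac{1-p}{1-\hat f}=0.$$ *)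

theory Defs
  imports "HOL-Probability.Probability"
begin

(* Expected exponential growth rate of the capital when the fraction f in [0, 1] is bet at every
   round.  It is extended-real valued because betting everything has growth rate -\<infinity> when
   p < 1, whereas the real logarithm of Isabelle/HOL has ln 0 = 0. *)
definition growth_rate :: "real \<Rightarrow> real measure \<Rightarrow> real \<Rightarrow> ereal" where
  "growth_rate p \<rho> f =
     (if f < 1 then ereal ((1 - p) * ln (1 - f) + p * (\<integral>b. ln (1 + b * f) \<partial>\<rho>)) else -\<infinity>)"

definition optimal_fraction :: "real \<Rightarrow> real measure \<Rightarrow> real" where
  "optimal_fraction p \<rho> = (THE f. is_arg_max (growth_rate p \<rho>) (\<lambda>f. f \<in> {0..1}) f)"

definition constant_payoff_fraction :: "real \<Rightarrow> real \<Rightarrow> real" where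
  "constant_payoff_fraction p b = (p * (1 + b) - 1) / b"

(* The closed formula is the optimal fraction of the game with constant pay-off b. *)
lemma optimal_fraction_return:
  assumes p: "0 < p" "p < 1" and b: "0 \<le> b" and fav: "p * (1 + b) > 1"
  shows "optimal_fraction p (return borel b) = constant_payoff_fraction p b"
    and "constant_payoff_fraction p b \<in> {0<..<1}"
proof -
  define s where "s = constant_payoff_fraction p b"
  define g where "g f = (1 - p) * ln (1 - f) + p * ln (1 + b * f)" for f
  have b0: "b > 0" using assms by (cases "b = 0") auto
  have s1: "1 - s = (1 - p) * (1 + b) / b" and s2: "1 + b * s = p * (1 + b)"
    using b0 by (simp_all add: s_def constant_payoff_fraction_def field_simps)
  have pos: "1 - s > 0" "1 + b * s > 0" using s1 s2 p b0 by simp_all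
  have s0: "s > 0" using fav b0 by (simp add: s_def constant_payoff_fraction_def)
  show "constant_payoff_fraction p b \<in> {0<..<1}" using s0 pos by (simp add: s_def)
  have G: "growth_rate p (return borel b) f = (if f < 1 then ereal (g f) else -\<infinity>)" for f
    by (simp add: growth_rate_def g_def integral_return)
  have less: "g h < g s" if h: "0 \<le> h" "h < 1" "h \<noteq> s" for h
  proof -
    define u v where "u = (1 - h) / (1 - s)" and "v = (1 + b * h) / (1 + b * s)"
    have hp: "1 + b * h > 0" using b h by (simp add: add_pos_nonneg)
    have u0: "u > 0" and v0: "v > 0" using pos h hp by (simp_all add: u_def v_def)
    have "u \<noteq> 1" using h pos by (simp add: u_def)
    then have "ln u < u - 1" using ln_le_minus_one[OF u0] ln_eq_minus_one[OF u0] by linarith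
    then have 1: "(1 - p) * ln u < (1 - p) * (u - 1)" using p by simp
    have 2: "p * ln v \<le> p * (v - 1)" using ln_le_minus_one[OF v0] p by simp
    have "(1 - p) * u = b * (1 - h) / (1 + b)" "p * v = (1 + b * h) / (1 + b)"
      using p b0 by (simp_all add: u_def v_def s1 s2)
    then have "(1 - p) * u + p * v = (b * (1 - h) + (1 + b * h)) / (1 + b)"
      by (simp add: add_divide_distrib)
    also have "\<dots> = 1" using b0 by (simp add: algebra_simps)
    finally have 3: "(1 - p) * (u - 1) + p * (v - 1) = 0" by (simp add: algebra_simps)
    have lns: "ln u = ln (1 - h) - ln (1 - s)" "ln v = ln (1 + b * h) - ln (1 + b * s)"
      using pos h hp by (simp_all add: u_def v_def ln_div)
    have "g h - g s = (1 - p) * ln u + p * ln v"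
      unfolding g_def lns by (simp add: right_diff_distrib)
    then show ?thesis using 1 2 3 by linarith
  qed
  have "is_arg_max (growth_rate p (return borel b)) (\<lambda>f. f \<in> {0..1}) f \<longleftrightarrow> f = s" for f
  proof
    assume m: "is_arg_max (growth_rate p (return borel b)) (\<lambda>f. f \<in> {0..1}) f"
    then have f: "0 \<le> f" and n: "\<not> growth_rate p (return borel b) s > growth_rate p (return borel b) f"
      using s0 pos by (auto simp: is_arg_max_def)
    show "f = s"
      using n less[of f] f pos by (auto simp: G split: if_splits)
  next
    assume "f = s"
    moreover have "\<not> growth_rate p (return borel b) h > growth_rate p (return borel b) s"
      if "h \<in> {0..1}" for h
      using less[of h] that pos by (cases "h = s") (auto simp: G)
    ultimately show "is_arg_max (growth_rate p (return borel b)) (\<lambda>f. f \<in> {0..1}) f"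
      using s0 pos by (auto simp: is_arg_max_def)
  qed
  then show "optimal_fraction p (return borel b) = constant_payoff_fraction p b"
    by (simp add: optimal_fraction_def s_def)
qed

end

theory Submission
  imports Defs
begin

text \<open>
  The growth rate \<open>g\<close> is strictly concave, so its maximiser is the zero of the marginal growth
  rate (\<open>marginal_growth\<close>) \<open>g'(f) = p * E[b / (1 + b f)] - (1 - p) / (1 - f)\<close>,
  and everything reduces to the sign of \<open>g'\<close> at two points.  At \<open>0\<close> it equals \<open>p * (1 + E b) - 1\<close>, which is positive for a
  favorable game.  Let \<open>s\<close> be the optimal fraction for the constant pay-off \<open>m = E b\<close>.
  For \<open>s > 0\<close> the function \<open>b \<mapsto> b / (1 + b s)\<close> is strictly concave, so by Jensen
  replacing \<open>b\<close> by its mean can only increase the expectation; since \<open>s\<close> is critical for the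
  constant pay-off, \<open>g'(s) \<le> 0\<close>.  The intermediate value theorem puts a zero of \<open>g'\<close> in
  \<open>(0, s]\<close>, and by concavity this zero is the unique maximiser (\<open>ex_critical_fraction\<close>,
  \<open>optimal_fraction_eqI\<close>).  If it is \<open>s\<close> itself, then Jensen's inequality is an equality, which
  forces \<open>b = m\<close> almost surely (\<open>jensen_gap_zero_imp_AE_eq\<close>).

  Two explicit forms replace general theory.  Concavity of \<open>g\<close> is used as "the graph lies
  below each tangent", which follows from \<open>ln u \<le> u - 1\<close> under the integral, without
  differentiating the integral.  Jensen's inequality comes from an exact formula for the distance
  between \<open>b / (1 + b s)\<close> and its tangent at \<open>m\<close>, which also settles the case of equality.
\<close>

section \<open>The game and its expected logarithmic returns\<close>

locale payoff_game = real_distribution \<rho> for \<rho> :: "real measure" +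
  fixes p :: real
  assumes p_pos: "0 < p" and p_less_1: "p < 1"
    and payoff_nonneg: "AE b in \<rho>. 0 \<le> b"
    and payoff_integrable: "integrable \<rho> (\<lambda>b. b)"
begin

definition mean_payoff :: real where
  "mean_payoff = (\<integral>b. b \<partial>\<rho>)"

definition real_growth :: "real \<Rightarrow> real" where
  "real_growth f = (1 - p) * ln (1 - f) + p * (\<integral>b. ln (1 + b * f) \<partial>\<rho>)"

definition marginal_growth :: "real \<Rightarrow> real" where
  "marginal_growth f = p * (\<integral>b. b / (1 + b * f) \<partial>\<rho>) - (1 - p) / (1 - f)"

lemma growth_rate_eq: "growth_rate p \<rho> f = (if f < 1 then ereal (real_growth f) else -\<infinity>)"
  by (simp add: growth_rate_def real_growth_def)

lemma integrable_log_return: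
  assumes "0 \<le> f" "f \<le> 1"
  shows "integrable \<rho> (\<lambda>b. ln (1 + b * f))"
proof (rule Bochner_Integration.integrable_bound[OF payoff_integrable])
  show "AE b in \<rho>. norm (ln (1 + b * f)) \<le> norm b"
    using payoff_nonneg
  proof eventually_elim
    case (elim b)
    have "ln (1 + b * f) \<le> b * f"
      using elim assms by (intro ln_add_one_self_le_self) simp
    also have "\<dots> \<le> b"
      using elim assms by (simp add: mult_left_le)
    finally show ?case
      using elim assms by simp
  qed
qed measurable

lemma payoff_ratio_bound:
  fixes b f :: real
  assumes "0 \<le> b" "0 \<le> f"
  shows "norm (b / (1 + b * f)) \<le> b"
proof -
  have "b / (1 + b * f) \<le> b / 1"
    using assms by (intro divide_left_mono) (simp_all add: add_pos_nonneg)
  then show ?thesis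
    using assms by simp
qed

lemma integrable_payoff_ratio:
  assumes "0 \<le> f"
  shows "integrable \<rho> (\<lambda>b. b / (1 + b * f))"
proof (rule Bochner_Integration.integrable_bound[OF payoff_integrable])
  show "AE b in \<rho>. norm (b / (1 + b * f)) \<le> norm b"
    using payoff_nonneg
  proof eventually_elim
    case (elim b)
    show ?case using payoff_ratio_bound[OF elim assms] elim by simp
  qed
qed measurable

section \<open>Concavity of the growth rate and its critical points\<close>

lemma ln_ratio_le:
  fixes x y :: real
  assumes "0 < x" "0 < y"
  shows "ln y \<le> ln x + (y - x) / x"
  using ln_le_minus_one[of "y / x"] assms by (simp add: ln_div diff_divide_distrib)

text \<open>
  Both logarithms in the growth rate lie below their tangents; the bound is strict because the
  term \<open>ln (1 - f)\<close> has positive weight, whatever the pay-off.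
\<close>
lemma real_growth_less_tangent:
  assumes x: "0 \<le> x" "x < 1" and y: "0 \<le> y" "y < 1" and ne: "x \<noteq> y"
  shows "real_growth y < real_growth x + (y - x) * marginal_growth x"
proof -
  define u where "u = (1 - y) / (1 - x)"
  have u: "0 < u" "u \<noteq> 1"
    using x y ne by (auto simp: u_def)
  have "ln u < u - 1"
    using ln_le_minus_one[OF u(1)] ln_eq_minus_one[OF u(1)] u(2) by linarith
  moreover have "ln u = ln (1 - y) - ln (1 - x)" "u - 1 = - ((y - x) / (1 - x))"
    using x y by (simp_all add: u_def ln_div field_simps)
  ultimately have loss: "ln (1 - y) < ln (1 - x) - (y - x) / (1 - x)"
    by linarith
  have "(\<integral>b. ln (1 + b * y) \<partial>\<rho>) \<le> (\<integral>b. ln (1 + b * x) + (y - x) * (b / (1 + b * x)) \<partial>\<rho>)"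
  proof (rule integral_mono_AE)
    show "AE b in \<rho>. ln (1 + b * y) \<le> ln (1 + b * x) + (y - x) * (b / (1 + b * x))"
      using payoff_nonneg
    proof eventually_elim
      case (elim b)
      have "0 < 1 + b * x" "0 < 1 + b * y"
        using elim x y by (simp_all add: add_pos_nonneg)
      from ln_ratio_le[OF this] show ?case
        by (simp add: algebra_simps)
    qed
  qed (use x y in \<open>auto intro!: integrable_log_return integrable_payoff_ratio integrable_mult_right simp del: times_divide_eq_right\<close>)
  also have "\<dots> = (\<integral>b. ln (1 + b * x) \<partial>\<rho>) + (y - x) * (\<integral>b. b / (1 + b * x) \<partial>\<rho>)"
    using x integrable_log_return[of x] integrable_payoff_ratio[of x]
    by (simp del: times_divide_eq_right)
  finally have win: "(\<integral>b. ln (1 + b * y) \<partial>\<rho>)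
      \<le> (\<integral>b. ln (1 + b * x) \<partial>\<rho>) + (y - x) * (\<integral>b. b / (1 + b * x) \<partial>\<rho>)" .
  have "real_growth y < (1 - p) * (ln (1 - x) - (y - x) / (1 - x))
      + p * ((\<integral>b. ln (1 + b * x) \<partial>\<rho>) + (y - x) * (\<integral>b. b / (1 + b * x) \<partial>\<rho>))"
    unfolding real_growth_def
    using loss win p_pos p_less_1 by (intro add_less_le_mono mult_strict_left_mono mult_left_mono) auto
  also have "\<dots> = real_growth x + (y - x) * marginal_growth x"
    by (simp add: real_growth_def marginal_growth_def algebra_simps)
  finally show ?thesis .
qed

text \<open>
  At a critical fraction the tangent is horizontal, so every other fraction does strictly worse;
  betting everything does too, its growth rate being \<open>-\<infinity>\<close>.
\<close>
lemma optimal_fraction_eqI: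
  assumes s: "0 \<le> s" "s < 1" and crit: "marginal_growth s = 0"
  shows "optimal_fraction p \<rho> = s"
proof -
  have less: "growth_rate p \<rho> h < growth_rate p \<rho> s" if "h \<in> {0..1}" "h \<noteq> s" for h
    using real_growth_less_tangent[OF s, of h] that s crit by (auto simp: growth_rate_eq)
  have "is_arg_max (growth_rate p \<rho>) (\<lambda>f. f \<in> {0..1}) f \<longleftrightarrow> f = s" for f
  proof
    assume "is_arg_max (growth_rate p \<rho>) (\<lambda>f. f \<in> {0..1}) f"
    then show "f = s"
      using less[of f] s unfolding is_arg_max_def by fastforce
  next
    assume "f = s"
    then show "is_arg_max (growth_rate p \<rho>) (\<lambda>f. f \<in> {0..1}) f"
      using less s unfolding is_arg_max_def by (metis atLeastAtMost_iff less_eq_real_def order.asym)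
  qed
  then show ?thesis
    by (simp add: optimal_fraction_def)
qed

text \<open>The pay-off itself dominates every ratio, and it is integrable.\<close>
lemma continuous_on_marginal_growth: "continuous_on {0..<1} marginal_growth"
proof -
  have "continuous_on {0..<1} (\<lambda>f. \<integral>b. b / (1 + b * f) \<partial>\<rho>)"
  proof (rule continuous_on_sequentiallyI)
    fix u :: "nat \<Rightarrow> real" and a
    assume u: "\<forall>n. u n \<in> {0..<1}" and a: "a \<in> {0..<1}" and lim: "u \<longlonglongrightarrow> a"
    show "(\<lambda>n. \<integral>b. b / (1 + b * u n) \<partial>\<rho>) \<longlonglongrightarrow> (\<integral>b. b / (1 + b * a) \<partial>\<rho>)"
    proof (rule integral_dominated_convergence[OF _ _ payoff_integrable])
      show "AE b in \<rho>. (\<lambda>n. b / (1 + b * u n)) \<longlonglongrightarrow> b / (1 + b * a)"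
        using payoff_nonneg
      proof eventually_elim
        case (elim b)
        have "0 < 1 + b * a"
          using elim a by (simp add: add_pos_nonneg)
        then show ?case
          by (intro tendsto_intros lim) simp
      qed
      show "AE b in \<rho>. norm (b / (1 + b * u n)) \<le> b" for n
        using payoff_nonneg
      proof eventually_elim
        case (elim b)
        then show ?case using u by (intro payoff_ratio_bound) auto
      qed
    qed measurable
  qed
  then show ?thesis
    unfolding marginal_growth_def by (intro continuous_intros) auto
qed

section \<open>Jensen's inequality with its case of equality\<close>

text \<open>
  The left-hand side is the height of the tangent at \<open>m\<close> above \<open>b \<mapsto> b / (1 + b s)\<close>.
  Written with a square, it shows both its sign and its zeros.
\<close>
lemma payoff_ratio_tangent_gap:
  fixes b m s :: real
  assumes "0 \<le> b" "0 \<le> m" "0 \<le> s"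
  shows "m / (1 + m * s) + (b - m) / (1 + m * s)\<^sup>2 - b / (1 + b * s)
    = s * (b - m)\<^sup>2 / ((1 + m * s)\<^sup>2 * (1 + b * s))"
proof -
  have "1 + m * s \<noteq> 0" "1 + b * s \<noteq> 0"
    using assms by (smt (verit) mult_nonneg_nonneg)+
  then show ?thesis
    by (simp add: divide_simps) algebra
qed

lemma mean_payoff_nonneg: "0 \<le> mean_payoff"
  unfolding mean_payoff_def by (rule integral_nonneg_AE[OF payoff_nonneg])

text \<open>
  Integrating the tangent height: the linear term of the tangent has mean zero, so only the
  value at the mean remains.
\<close>
lemma jensen_gap:
  assumes s: "0 \<le> s"
  defines "gap \<equiv> \<lambda>b. s * (b - mean_payoff)\<^sup>2 / ((1 + mean_payoff * s)\<^sup>2 * (1 + b * s))"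
  shows "integrable \<rho> gap" "AE b in \<rho>. 0 \<le> gap b"
    and "(\<integral>b. gap b \<partial>\<rho>) = mean_payoff / (1 + mean_payoff * s) - (\<integral>b. b / (1 + b * s) \<partial>\<rho>)"
proof -
  let ?m = mean_payoff
  let ?t = "\<lambda>b. ?m / (1 + ?m * s) + (b - ?m) / (1 + ?m * s)\<^sup>2 - b / (1 + b * s)"
  have gap_eq: "AE b in \<rho>. ?t b = gap b"
    using payoff_nonneg
    by eventually_elim (simp add: gap_def payoff_ratio_tangent_gap mean_payoff_nonneg s)
  have meas: "gap \<in> borel_measurable \<rho>"
    unfolding gap_def by measurable
  have int: "integrable \<rho> ?t"
    using payoff_integrable integrable_payoff_ratio[OF s] by auto
  show "integrable \<rho> gap"
    by (rule integrable_cong_AE_imp[OF int meas gap_eq])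
  show "AE b in \<rho>. 0 \<le> gap b"
    using payoff_nonneg by eventually_elim (use s in \<open>simp add: gap_def\<close>)
  have "(\<integral>b. gap b \<partial>\<rho>) = (\<integral>b. ?t b \<partial>\<rho>)"
    using gap_eq by (intro integral_cong_AE meas borel_measurable_integrable[OF int]) auto
  also have "\<dots> = ?m / (1 + ?m * s) - (\<integral>b. b / (1 + b * s) \<partial>\<rho>)"
    using payoff_integrable integrable_payoff_ratio[OF s]
    by (simp add: mean_payoff_def[symmetric] prob_space[unfolded space_eq_univ])
  finally show "(\<integral>b. gap b \<partial>\<rho>) = ?m / (1 + ?m * s) - (\<integral>b. b / (1 + b * s) \<partial>\<rho>)" .
qed

lemma integral_payoff_ratio_le:
  assumes "0 \<le> s"
  shows "(\<integral>b. b / (1 + b * s) \<partial>\<rho>) \<le> mean_payoff / (1 + mean_payoff * s)"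
  using integral_nonneg_AE[OF jensen_gap(2)[OF assms]] jensen_gap(3)[OF assms] by simp

text \<open>
  A nonnegative gap with zero integral vanishes almost everywhere, and for \<open>s > 0\<close> it
  vanishes only at the mean.
\<close>
lemma jensen_gap_zero_imp_AE_eq:
  assumes s: "0 < s"
    and eq: "(\<integral>b. b / (1 + b * s) \<partial>\<rho>) = mean_payoff / (1 + mean_payoff * s)"
  shows "AE b in \<rho>. b = mean_payoff"
proof -
  note gap = jensen_gap[OF less_imp_le[OF s]]
  have "AE b in \<rho>. s * (b - mean_payoff)\<^sup>2 / ((1 + mean_payoff * s)\<^sup>2 * (1 + b * s)) = 0"
    using integral_nonneg_eq_0_iff_AE[OF gap(1,2)] gap(3) eq by simp
  then show ?thesis
    using payoff_nonneg
  proof eventually_elim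
    case (elim b)
    have "1 + mean_payoff * s \<noteq> 0" "1 + b * s \<noteq> 0"
      using elim s mean_payoff_nonneg by (smt (verit) mult_nonneg_nonneg)+
    then show ?case using elim s by simp
  qed
qed

lemma eq_return_if_AE_const:
  assumes "AE b in \<rho>. b = c"
  shows "\<rho> = return borel c"
proof (rule measure_eqI)
  fix A assume A: "A \<in> sets \<rho>"
  have "emeasure \<rho> A = emeasure \<rho> (if c \<in> A then space \<rho> else {})"
    by (rule emeasure_eq_AE) (use assms A in auto)
  also have "\<dots> = emeasure (return borel c) A"
    using A emeasure_space_1 by simp
  finally show "emeasure \<rho> A = emeasure (return borel c) A" .
qed simp

section \<open>Comparison with the constant pay-off\<close>

text \<open>
  The first-order condition of the game with constant pay-off \<open>E b\<close>, whose marginal growth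
  rate is the left-hand side as a function of \<open>s\<close>.
\<close>
lemma constant_payoff_critical:
  assumes fav: "p * (1 + mean_payoff) > 1"
  defines "s \<equiv> constant_payoff_fraction p mean_payoff"
  shows "p * (mean_payoff / (1 + mean_payoff * s)) - (1 - p) / (1 - s) = 0"
proof -
  have m: "0 < mean_payoff"
    using fav p_less_1 mean_payoff_nonneg by (cases "mean_payoff = 0") auto
  have "1 + mean_payoff * s = p * (1 + mean_payoff)" "1 - s = (1 - p) * (1 + mean_payoff) / mean_payoff"
    using m by (simp_all add: s_def constant_payoff_fraction_def field_simps)
  then show ?thesis
    using m p_pos p_less_1 by simp
qed

text \<open>
  The marginal growth rate is positive at \<open>0\<close> because the game is favorable; at \<open>s\<close> Jensen's
  inequality bounds it by that of the constant pay-off, which vanishes there.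
\<close>
lemma ex_critical_fraction:
  assumes fav: "p * (1 + mean_payoff) > 1"
  defines "s \<equiv> constant_payoff_fraction p mean_payoff"
  obtains f where "0 < f" "f \<le> s" "marginal_growth f = 0"
proof -
  have s: "0 < s" "s < 1"
    using optimal_fraction_return(2)[OF p_pos p_less_1 mean_payoff_nonneg fav] by (simp_all add: s_def)
  have at_0: "0 < marginal_growth 0"
    using fav by (simp add: marginal_growth_def mean_payoff_def algebra_simps)
  have "marginal_growth s \<le> p * (mean_payoff / (1 + mean_payoff * s)) - (1 - p) / (1 - s)"
    using integral_payoff_ratio_le[of s] s p_pos
    by (simp add: marginal_growth_def mult_left_mono del: times_divide_eq_right)
  also have "\<dots> = 0"
    using constant_payoff_critical[OF fav] by (simp add: s_def)
  finally have at_s: "marginal_growth s \<le> 0" .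
  have "continuous_on {0..s} marginal_growth"
    by (rule continuous_on_subset[OF continuous_on_marginal_growth]) (use s in auto)
  with at_0 at_s s obtain f where "0 \<le> f" "f \<le> s" "marginal_growth f = 0"
    using IVT2'[of marginal_growth s 0 0] by auto
  moreover have "f \<noteq> 0" using \<open>marginal_growth f = 0\<close> at_0 by auto
  ultimately show ?thesis using that[of f] by auto
qed

end

theorem corollary3p2:
  fixes p :: real and \<rho> :: "real measure"
  assumes "0 < p" and "p < 1"
    and "real_distribution \<rho>"
    and "AE b in \<rho>. 0 \<le> b"
    and "integrable \<rho> (\<lambda>b. b)"
    and "p * (1 + (\<integral>b. b \<partial>\<rho>)) > 1"
  shows "optimal_fraction p \<rho> \<le> constant_payoff_fraction p (\<integral>b. b \<partial>\<rho>) \<and>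
    (optimal_fraction p \<rho> = constant_payoff_fraction p (\<integral>b. b \<partial>\<rho>) \<longrightarrow> (\<exists>c. \<rho> = return borel c))"
proof -
  interpret payoff_game \<rho> p
    by (intro payoff_game.intro payoff_game_axioms.intro assms)
  have fav: "p * (1 + mean_payoff) > 1"
    using assms(6) by (simp add: mean_payoff_def)
  define s where "s = constant_payoff_fraction p mean_payoff"
  have s: "s < 1"
    using optimal_fraction_return(2)[OF p_pos p_less_1 mean_payoff_nonneg fav] by (simp add: s_def)
  obtain f where f: "0 < f" "f \<le> s" and crit: "marginal_growth f = 0"
    using ex_critical_fraction[OF fav] unfolding s_def by blast
  have opt: "optimal_fraction p \<rho> = f"
    by (rule optimal_fraction_eqI) (use f s crit in auto)
  have "\<exists>c. \<rho> = return borel c" if "f = s"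
  proof -
    have "p * (\<integral>b. b / (1 + b * s) \<partial>\<rho>) = p * (mean_payoff / (1 + mean_payoff * s))"
      using crit constant_payoff_critical[OF fav] unfolding that marginal_growth_def s_def by linarith
    then have "(\<integral>b. b / (1 + b * s) \<partial>\<rho>) = mean_payoff / (1 + mean_payoff * s)"
      using p_pos by (simp del: times_divide_eq_right)
    then show ?thesis
      using jensen_gap_zero_imp_AE_eq[of s] f(1) that eq_return_if_AE_const by blast
  qed
  then show ?thesis
    using f(2) opt by (auto simp: s_def mean_payoff_def)
qed

end
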